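(* Let $G$ be a graph and let $\mathcal{F}$ be a hereditary family of graphs with $K_2\in\mathcal{F}$. Then, as $n\to\infty$ with $G$ and $\mathcal{F}$ fixed: (i) If $\chi_{\mathcal{F}}(G)\ge 3$, then $f(n,G|\mathcal{F})=(1+o(1))\,\mathrm{ex}(n,K_{\chi_{\mathcal{F}}(G)})$. (ii) If $\chi_{\mathcal{F}}(G)=2$, then $f(n,G|\mathcal{F})=o(n^2)$. (iii) If $\chi_{\mathcal{F}}(G)=1$, then $f(n,G|\mathcal{F})=1$ (for every $n\ge |G|$).
   Context: All graphs are finite and simple; $|G|$ is the number of vertices of $G$. A family $\mathcal{F}$ of graphs (closed under isomorphism) is hereditary if $H\in\mathcal{F}$ and $H'\subset H$ (subgraph, not necessarily induced) imply $H'\in\mathcal{F}$; isolated vertices are disregarded for membership in $\mathcal{F}$ and edgeless graphs are trivially regarded as members (so that e.g. $\{K_2\}$ and $\{tK_2: t\ge1\}$ count as hereditary families). For a subgraph $D$ of $G$, $G-D$ denotes the graph on $V(G)$ obtained by deleting the edges of $D$. The $\mathcal{F}$-deck of $G$ is $D(G|\mathcal{F})=\{G-D : D\subset G,\ D\in\mathcal{F}\}$, and the reduced chromatic number is $\chi_{\mathcal{F}}(G)=\min\{\chi(H): H\in D(G|\mathcal{F})\}$. For $n\ge |G|$, $f(n,G|\mathcal{F})$ is the smallest positive integer $k$ such that in every edge coloring of $K_n$ using at least $k$ colors there is a (not necessarily induced) copy of $G$ in which, for each color, the edges of that copy having that color form a member of $\mathcal{F}$. $\mathrm{ex}(n,H)$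 is the Turán number: the maximum number of edges in an $n$-vertex graph containing no subgraph isomorphic to $H$. *)

theory Defs
  imports Complex_Main "HOL-Library.Ramsey" "HOL-Library.Landau_Symbols"
begin

type_synonym 'a graph = "'a set \<times> 'a set set"

abbreviation verts :: "'a graph \<Rightarrow> 'a set" where "verts \<equiv> fst"

abbreviation edges :: "'a graph \<Rightarrow> 'a set set" where "edges \<equiv> snd"

definition simple_graph :: "'a graph \<Rightarrow> bool" where
  "simple_graph G \<longleftrightarrow> finite (verts G) \<and> edges G \<subseteq> nsets (verts G) 2"

definition complete_graph :: "nat \<Rightarrow> nat graph" where
  "complete_graph n = ({..<n}, nsets {..<n} 2)"

definition subgraph :: "'a graph \<Rightarrow> 'a graph \<Rightarrow> bool" where
  "subgraph H G \<longleftrightarrow>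
     simple_graph H \<and> simple_graph G \<and> verts H \<subseteq> verts G \<and> edges H \<subseteq> edges G"

definition graph_iso :: "'a graph \<Rightarrow> 'b graph \<Rightarrow> bool" where
  "graph_iso G H \<longleftrightarrow>
     (\<exists>\<phi>. bij_betw \<phi> (verts G) (verts H) \<and> edges H = (\<lambda>e. \<phi> ` e) ` edges G)"

definition is_copy_in :: "'a graph \<Rightarrow> 'b graph \<Rightarrow> 'a graph \<Rightarrow> bool" where
  "is_copy_in H G K \<longleftrightarrow> subgraph H K \<and> graph_iso G H"

definition delete_edges :: "'a graph \<Rightarrow> 'a graph \<Rightarrow> 'a graph" where
  "delete_edges G D = (verts G, edges G - edges D)"

definition proper_coloring :: "'a graph \<Rightarrow> nat \<Rightarrow> ('a \<Rightarrow> nat) \<Rightarrow> bool" where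
  "proper_coloring G k c \<longleftrightarrow>
     c ` verts G \<subseteq> {..<k} \<and> (\<forall>u v. {u, v} \<in> edges G \<longrightarrow> c u \<noteq> c v)"

definition chromatic_number :: "'a graph \<Rightarrow> nat" where
  "chromatic_number G = (LEAST k. \<exists>c. proper_coloring G k c)"

text \<open>
  Every finite graph is isomorphic to one with vertices in \<^typ>\<open>nat\<close>, so a family closed under
  isomorphism is represented by its members on \<^typ>\<open>nat\<close>. The last two clauses express that
  isolated vertices are disregarded and that edgeless graphs are members by convention. Thus
  the family consisting of the single edge alone is represented by the set of all graphs
  with at most one edge.
\<close>

definition hereditary :: "nat graph set \<Rightarrow> bool" where
  "hereditary F \<longleftrightarrow>
     (\<forall>H\<in>F. simple_graph H) \<and>
     (\<forall>H\<in>F. \<forall>H'. simple_graph H' \<and> graph_iso H H' \<longrightarrow> H' \<in> F) \<and>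
     (\<forall>H\<in>F. \<forall>H'. subgraph H' H \<longrightarrow> H' \<in> F) \<and>
     (\<forall>H\<in>F. \<forall>H'. simple_graph H' \<and> edges H' = edges H \<longrightarrow> H' \<in> F) \<and>
     (\<forall>H. simple_graph H \<and> edges H = {} \<longrightarrow> H \<in> F)"

definition deck :: "nat graph \<Rightarrow> nat graph set \<Rightarrow> nat graph set" where
  "deck G F = {delete_edges G D | D. subgraph D G \<and> D \<in> F}"

definition reduced_chromatic_number :: "nat graph set \<Rightarrow> nat graph \<Rightarrow> nat" where
  "reduced_chromatic_number F G = Min (chromatic_number ` deck G F)"

definition color_class :: "('a set \<Rightarrow> nat) \<Rightarrow> 'a graph \<Rightarrow> nat \<Rightarrow> 'a graph" where
  "color_class c H i = (verts H, {e \<in> edges H. c e = i})"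

text \<open>
  The least element below always exists: no coloring of the complete graph uses more than
  \<^term>\<open>n choose 2\<close> colors.
\<close>

definition color_threshold :: "nat \<Rightarrow> nat graph \<Rightarrow> nat graph set \<Rightarrow> nat" where
  "color_threshold n G F = (LEAST k. k > 0 \<and>
     (\<forall>c :: nat set \<Rightarrow> nat. card (c ` edges (complete_graph n)) \<ge> k \<longrightarrow>
        (\<exists>H. is_copy_in H G (complete_graph n) \<and> (\<forall>i. color_class c H i \<in> F))))"

definition turan_number :: "nat \<Rightarrow> nat graph \<Rightarrow> nat" where
  "turan_number n H = Max {card (edges K) | K :: nat graph.
     simple_graph K \<and> card (verts K) = n \<and> \<not> (\<exists>H'. is_copy_in H' H K)}"

end

theory Submission
  imports Defs
begin

text \<open>
  Write \<open>k\<close> for the reduced chromatic number of \<open>G\<close> and \<open>r = k - 1\<close>. For \<open>k \<ge> 2\<close>, the color threshold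
  divided by \<open>n\<^sup>2\<close> tends to \<open>(1 - 1 / r) / 2\<close>. The Turan number of the complete graph on \<open>k\<close>
  vertices, divided by \<open>n\<^sup>2\<close>, has the same limit, and this limit is \<open>0\<close> for \<open>k = 2\<close> and positive for \<open>k \<ge> 3\<close>.

  For the upper bound, pick one edge of each color. If there are at least \<open>(1 - 1 / r + \<epsilon>) * n\<^sup>2 / 2\<close>
  colors, then by the Erdos-Stone theorem (\<open>erdos_stone\<close>) these edges contain a complete
  \<open>k\<close>-partite graph with large parts, all of whose edges have different colors. Let \<open>D\<close> be a member of
  the family with \<open>G - D\<close> colorable with \<open>k\<close> colors. Embedding the color classes of \<open>G - D\<close> into the
  parts, the edges between parts have different colors, and the edges within parts belong to
  \<open>D\<close>. Since the family is hereditary, the colors of the latter are irrelevant as long as they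
  differ from those of the edges between parts, and a counting argument produces such an embedding
  (\<open>good_copy_if_rainbow_multipartite\<close>).

  For the lower bound, give different colors to the edges of the Turan graph with \<open>r\<close> parts, and one
  common color to all other pairs (\<open>color_threshold_lower\<close>). The common color class of a copy of
  \<open>G\<close> cannot be in the family, because deleting it would leave an \<open>r\<close>-colorable graph.

  The same Turan graph bounds the Turan number from below, and the Erdos-Stone theorem with parts of
  size one bounds it from above, so the two quantities can be compared without the exact value of
  the Turan number. If \<open>k = 1\<close>, then \<open>G\<close> itself lies in the family, and every copy of it is
  suitable.
\<close>

section \<open>Dense graphs contain large complete multipartite graphs\<close>

lemma finite_edges: "simple_graph G \<Longrightarrow> finite (edges G)"
  using finite_imp_finite_nsets finite_subset by (auto simp: simple_graph_def)

text \<open>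
  The parts of a complete \<open>m\<close>-partite subgraph, each of size \<open>t\<close>. In a simple graph they
  are disjoint because \<open>{x, x}\<close> is never an edge. Pairs inside a part are unrestricted.
\<close>

definition multipartite_in :: "'a graph \<Rightarrow> nat \<Rightarrow> nat \<Rightarrow> (nat \<Rightarrow> 'a set) \<Rightarrow> bool" where
  "multipartite_in K m t P \<longleftrightarrow>
     (\<forall>i<m. P i \<subseteq> verts K \<and> card (P i) = t) \<and>
     (\<forall>i<m. \<forall>j<m. i \<noteq> j \<longrightarrow> (\<forall>x\<in>P i. \<forall>y\<in>P j. {x, y} \<in> edges K))"

text \<open>
  The engine of the Erdos-Stone theorem. A vertex outside \<open>W\<close>, the set of those with at least \<open>t\<close>
  neighbours in every part, misses at least \<open>T - t\<close> of the at most \<open>m * T\<close> vertices in the parts,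
  while each of these is missed at most \<open>a * |K|\<close> times. Double counting therefore
  leaves \<open>W\<close> at least the proportion \<open>1 - b\<close> of all vertices. There are only \<open>(2 ^ T) ^ m\<close> ways to choose a
  subset of each part, so by the pigeonhole principle \<open>t\<close> vertices of \<open>W\<close> have a common choice of \<open>t\<close>
  neighbours in each part. They form the new part, and these neighbours the others.
\<close>

lemma add_part:
  fixes a b :: real
  assumes fin: "finite (verts K)"
    and sparse: "\<forall>x\<in>verts K. real (card {v \<in> verts K. {v, x} \<notin> edges K}) \<le> a * card (verts K)"
    and P: "multipartite_in K m T P"
    and T: "t < T" "m * a * T \<le> b * (real T - t)"
    and large: "t * (2 ^ T) ^ m \<le> (1 - b) * card (verts K)"
  shows "\<exists>Q. multipartite_in K (Suc m) t Q"
proof -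
  define V where "V = verts K"
  define S where "S = (\<Union>i<m. P i)"
  define nb where "nb v i = {x \<in> P i. {v, x} \<in> edges K}" for v i
  define W where "W = {v \<in> V. \<forall>i<m. t \<le> card (nb v i)}"
  have finV: "finite V" using fin by (simp add: V_def)
  have PV: "P i \<subseteq> V" and cP: "card (P i) = T" if "i < m" for i
    using P that by (auto simp: multipartite_in_def V_def)
  have finP: "finite (P i)" if "i < m" for i using PV[OF that] finV finite_subset by blast
  have finS: "finite S" and SV: "S \<subseteq> V" using finP PV by (auto simp: S_def)
  have cS: "card S \<le> m * T"
    using card_UN_le[of "{..<m}" P] cP by (simp add: S_def)
  have WV: "W \<subseteq> V" and finW: "finite W" using finV by (auto simp: W_def)
  have missing: "real T - t \<le> card {x \<in> S. {v, x} \<notin> edges K}" if v: "v \<in> V - W" for v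
  proof -
    obtain i where i: "i < m" "card (nb v i) < t" using v by (auto simp: W_def not_le)
    have "card (P i - nb v i) = T - card (nb v i)"
      using finP[OF i(1)] cP[OF i(1)] by (subst card_Diff_subset) (auto simp: nb_def)
    moreover have "card (P i - nb v i) \<le> card {x \<in> S. {v, x} \<notin> edges K}"
      using i finS by (intro card_mono) (auto simp: nb_def S_def)
    ultimately show ?thesis using i T(1) by linarith
  qed
  have "card (V - W) * (real T - t) \<le> (\<Sum>v\<in>V - W. real (card {x \<in> S. {v, x} \<notin> edges K}))"
    using sum_bounded_below[of "V - W" "real T - t"] missing by (simp add: mult.commute)
  also have "\<dots> = real (\<Sum>v\<in>V - W. card {x \<in> S. {v, x} \<notin> edges K})" by simp
  also have "\<dots> = real (\<Sum>x\<in>S. card {v \<in> V - W. {v, x} \<notin> edges K})"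
    using finV finS by (subst sum_multicount_gen) auto
  also have "\<dots> \<le> (\<Sum>x\<in>S. a * card V)"
  proof (unfold of_nat_sum, rule sum_mono)
    fix x assume "x \<in> S"
    then have "real (card {v \<in> V. {v, x} \<notin> edges K}) \<le> a * card V"
      using sparse SV by (auto simp: V_def)
    moreover have "card {v \<in> V - W. {v, x} \<notin> edges K} \<le> card {v \<in> V. {v, x} \<notin> edges K}"
      using finV by (intro card_mono) auto
    ultimately show "real (card {v \<in> V - W. {v, x} \<notin> edges K}) \<le> a * card V" by linarith
  qed
  also have "\<dots> = card S * (a * card V)" by simp
  also have "\<dots> \<le> (m * T) * (a * card V)"
  proof (cases "S = {}")
    case False
    then obtain x where "x \<in> V" using SV by auto
    then have "0 \<le> a * card V" using sparse by (auto simp: V_def intro: order_trans[rotated])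
    then show ?thesis using cS by (intro mult_right_mono) (auto simp flip: of_nat_mult)
  next
    case True
    show ?thesis
    proof (cases "m = 0 \<or> T = 0")
      case False
      then have "P 0 = {}" "card (P 0) = T" using True cP by (auto simp: S_def)
      then show ?thesis using False by simp
    qed (use True in auto)
  qed
  also have "\<dots> = (m * a * T) * card V" by simp
  also have "\<dots> \<le> (b * (real T - t)) * card V" using T(2) by (intro mult_right_mono) auto
  finally have "card (V - W) * (real T - t) \<le> (b * card V) * (real T - t)" by (simp add: mult_ac)
  then have "card (V - W) \<le> b * card V" using T(1) by simp
  moreover have "card (V - W) = card V - card W" "card W \<le> card V"
    using WV finW finV by (auto intro: card_Diff_subset card_mono)
  ultimately have "(1 - b) * card V \<le> card W" by (simp add: left_diff_distrib)
  then have "real (t * (2 ^ T) ^ m) \<le> real (card W)"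
    using order_trans[OF large] by (simp add: V_def)
  then have cW: "t * (2 ^ T) ^ m \<le> card W" by (simp only: of_nat_le_iff)
  define B where "B = (\<Pi>\<^sub>E i\<in>{..<m}. Pow (P i))"
  have cB: "card B = (2 ^ T) ^ m" and finB: "finite B"
    using finP cP by (auto simp: B_def card_PiE card_Pow intro!: finite_PiE)
  have "\<exists>q. q \<subseteq> nb v i \<and> card q = t" if "v \<in> W" "i < m" for v i
    using that obtain_subset_with_card_n[of t "nb v i"] by (auto simp: W_def)
  then obtain q where q: "\<And>v i. v \<in> W \<Longrightarrow> i < m \<Longrightarrow> q v i \<subseteq> nb v i \<and> card (q v i) = t"
    by metis
  define f where "f v = (\<lambda>i\<in>{..<m}. q v i)" for v
  have "f \<in> W \<rightarrow> B" using q by (fastforce simp: f_def B_def nb_def)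
  moreover have "B \<noteq> {}" using cB by auto
  ultimately obtain y where y: "card W \<le> card (f -` {y} \<inter> W) * card B"
    using pigeonhole_card finW finB by metis
  have "t * card B \<le> card (f -` {y} \<inter> W) * card B"
    using order_trans[OF cW[folded cB] y] .
  then have "t \<le> card (f -` {y} \<inter> W)" using cB by simp
  then obtain N where N: "N \<subseteq> f -` {y} \<inter> W" "card N = t"
    using obtain_subset_with_card_n by metis
  have qy: "q v i = y i" if "v \<in> f -` {y} \<inter> W" "i < m" for v i
    using that by (auto simp: f_def restrict_def)
  show ?thesis
  proof (cases "t = 0")
    case True
    then show ?thesis by (intro exI[of _ "\<lambda>_. {}"]) (simp add: multipartite_in_def)
  next
    case False
    then obtain v0 where v0: "v0 \<in> N" using N by fastforce
    define R where "R i = (if i < m then y i else N)" for i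
    have yq: "y i \<subseteq> nb v i \<and> card (y i) = t" if "v \<in> N" "i < m" for v i
    proof -
      have v: "v \<in> f -` {y} \<inter> W" using N that by blast
      then show ?thesis using q[of v i] qy[OF v] that by auto
    qed
    have y0: "y i \<subseteq> P i" "card (y i) = t" if "i < m" for i
      using yq[OF v0 that] by (auto simp: nb_def)
    have "multipartite_in K (Suc m) t R"
      unfolding multipartite_in_def
    proof (intro conjI allI impI ballI)
      fix i assume "i < Suc m"
      show "R i \<subseteq> verts K" using y0[of i] PV[of i] N WV by (auto simp: R_def V_def)
      show "card (R i) = t" using y0[of i] N by (auto simp: R_def)
    next
      fix i j x z assume ij: "i < Suc m" "j < Suc m" "i \<noteq> j" and xz: "x \<in> R i" "z \<in> R j"
      consider "i < m" "j < m" | "i = m" "j < m" | "i < m" "j = m" using ij by linarith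
      then show "{x, z} \<in> edges K"
      proof cases
        case 1
        then have "x \<in> P i" "z \<in> P j" using xz y0(1)[of i] y0(1)[of j] by (auto simp: R_def)
        then show ?thesis using P ij 1 by (simp add: multipartite_in_def)
      next
        case 2
        then show ?thesis using xz yq[of x j] by (auto simp: R_def nb_def)
      next
        case 3
        then have "{z, x} \<in> edges K" using xz yq[of z i] by (auto simp: R_def nb_def)
        then show ?thesis by (simp add: insert_commute)
      qed
    qed
    then show ?thesis by blast
  qed
qed

text \<open>
  Parts are added one at a time. The condition \<open>i * a < 1\<close> is what makes the double counting in
  \<open>add_part\<close> succeed when \<open>i\<close> parts are already there; each part shrinks from \<open>T\<close> to \<open>t\<close> in the
  process, so the induction runs over all \<open>t\<close> simultaneously. Note that a vertex counts as a
  non-neighbour of itself.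
\<close>

lemma multipartite_of_few_non_neighbours:
  fixes a :: real
  assumes "0 \<le> a" "\<forall>i<m. real i * a < 1"
  shows "\<exists>n0. \<forall>K :: 'a graph. finite (verts K) \<longrightarrow> n0 \<le> card (verts K) \<longrightarrow>
           (\<forall>x\<in>verts K. real (card {v \<in> verts K. {v, x} \<notin> edges K}) \<le> a * card (verts K)) \<longrightarrow>
           (\<exists>P. multipartite_in K m t P)"
  using assms(2)
proof (induction m arbitrary: t)
  case 0
  then show ?case by (auto simp: multipartite_in_def)
next
  case (Suc m)
  define b where "b = (1 + m * a) / 2"
  have ma: "m * a < 1" using Suc.prems by simp
  have b: "m * a < b" "b < 1"
    using ma field_less_half_sum[of "m * a" 1] gt_half_sum[of "m * a" 1]
    by (simp_all add: b_def add.commute)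
  define T where "T = Suc t + nat \<lceil>b * t / (b - m * a)\<rceil>"
  have "b * t / (b - m * a) \<le> T" unfolding T_def by linarith
  then have "m * a * T \<le> b * (real T - t)"
    using b by (simp add: field_simps)
  moreover have "t < T" by (simp add: T_def)
  ultimately have T: "t < T" "m * a * T \<le> b * (real T - t)" by auto
  have "\<forall>i<m. real i * a < 1" using Suc.prems by simp
  then obtain n1 where n1: "\<forall>K :: 'a graph. finite (verts K) \<longrightarrow> n1 \<le> card (verts K) \<longrightarrow>
      (\<forall>x\<in>verts K. real (card {v \<in> verts K. {v, x} \<notin> edges K}) \<le> a * card (verts K)) \<longrightarrow>
      (\<exists>P. multipartite_in K m T P)"
    using Suc.IH[of T] by blast
  define n2 where "n2 = nat \<lceil>real t * (2 ^ T) ^ m / (1 - b)\<rceil>"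
  have n2: "real t * (2 ^ T) ^ m \<le> (1 - b) * n" if "n2 \<le> n" for n
  proof -
    have "real t * (2 ^ T) ^ m / (1 - b) \<le> n" using that unfolding n2_def by linarith
    then show ?thesis using b by (simp add: field_simps)
  qed
  show ?case
  proof (intro exI[of _ "max n1 n2"] allI impI)
    fix K :: "'a graph"
    assume K: "finite (verts K)" "max n1 n2 \<le> card (verts K)"
      "\<forall>x\<in>verts K. real (card {v \<in> verts K. {v, x} \<notin> edges K}) \<le> a * card (verts K)"
    then obtain P where P: "multipartite_in K m T P" using n1 by (meson max.boundedE)
    show "\<exists>P. multipartite_in K (Suc m) t P"
      using add_part[OF K(1,3) P T n2] K(2) by simp
  qed
qed

text \<open>
  Instead of removing vertices of small degree one by one, take \<open>U\<close> to maximise the excess of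
  the number of edges inside \<open>U\<close> over \<open>s * |U| * (|U| + 1) / 2\<close>. Removing a vertex \<open>v\<close> of \<open>U\<close> changes
  it by \<open>s * |U| - deg v\<close>, which gives the degree bound, and \<open>U\<close> is large because its excess, at
  most \<open>|U|\<^sup>2 / 2\<close>, is at least that of the whole graph.
\<close>

lemma dense_subset_with_min_degree:
  fixes s \<epsilon> :: real
  assumes K: "simple_graph K" and n: "n = card (verts K)" and "0 \<le> s"
    and dense: "(s + \<epsilon>) * n\<^sup>2 / 2 \<le> card (edges K)"
  obtains U where "U \<subseteq> verts K" "\<epsilon> * n\<^sup>2 - s * n \<le> (card U)\<^sup>2"
    "\<forall>v\<in>U. s * card U \<le> card {w \<in> U. {v, w} \<in> edges K}"
proof -
  define V where "V = verts K"
  have fin: "finite V" and E: "edges K \<subseteq> nsets V 2" using K by (auto simp: simple_graph_def V_def)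
  have finE: "finite (edges K)" using K by (rule finite_edges)
  define e where "e U = {d \<in> edges K. d \<subseteq> U}" for U
  define g where "g U = card (e U) - s * (card U * (card U + 1) / 2)" for U
  have "Max (g ` Pow V) \<in> g ` Pow V" using fin by (intro Max_in) auto
  then obtain U where U: "U \<subseteq> V" and gU: "Max (g ` Pow V) = g U" by blast
  have max: "g U' \<le> g U" if "U' \<subseteq> V" for U'
    unfolding gU[symmetric] using fin that by (intro Max_ge) auto
  have finU: "finite U" using U fin finite_subset by blast
  have "s * card U \<le> card {w \<in> U. {v, w} \<in> edges K}" if v: "v \<in> U" for v
  proof -
    have "e U = e (U - {v}) \<union> (\<lambda>w. {v, w}) ` {w \<in> U. {v, w} \<in> edges K}"
    proof (intro equalityI subsetI)
      fix d assume d: "d \<in> e U"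
      then obtain x y where xy: "d = {x, y}" using E by (auto simp: e_def elim!: nsets2_E)
      show "d \<in> e (U - {v}) \<union> (\<lambda>w. {v, w}) ` {w \<in> U. {v, w} \<in> edges K}"
      proof (cases "v \<in> d")
        case True
        then obtain w where "d = {v, w}" using xy by auto
        then show ?thesis using d by (auto simp: e_def)
      qed (use d in \<open>auto simp: e_def\<close>)
    qed (use v in \<open>auto simp: e_def\<close>)
    moreover have "e (U - {v}) \<inter> (\<lambda>w. {v, w}) ` {w \<in> U. {v, w} \<in> edges K} = {}"
      by (auto simp: e_def)
    moreover have "inj_on (\<lambda>w. {v, w}) {w \<in> U. {v, w} \<in> edges K}"
      by (auto simp: inj_on_def doubleton_eq_iff)
    moreover have "finite (e (U - {v}))" using finE by (auto simp: e_def)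
    ultimately have "card (e U) = card (e (U - {v})) + card {w \<in> U. {v, w} \<in> edges K}"
      using finU by (simp add: card_Un_disjoint card_image)
    moreover have "g (U - {v}) \<le> g U" using max U by blast
    moreover obtain c where "card U = Suc c" "card (U - {v}) = c"
      using v finU by (metis card_Suc_Diff1)
    ultimately show ?thesis by (simp add: g_def field_simps)
  qed
  moreover have "\<epsilon> * n\<^sup>2 - s * n \<le> (card U)\<^sup>2"
  proof -
    have "e U \<subseteq> nsets U 2" using E by (auto simp: e_def nsets_def)
    then have "card (e U) \<le> card U choose 2"
      using card_mono[OF finite_imp_finite_nsets[OF finU]] by (metis card_nsets)
    also have "\<dots> \<le> (card U)\<^sup>2 div 2" unfolding choose_two power2_eq_square
      by (intro div_le_mono mult_le_mono2) simp
    finally have "2 * card (e U) \<le> (card U)\<^sup>2" by linarith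
    then have "2 * real (card (e U)) \<le> (card U)\<^sup>2"
      by (metis of_nat_le_iff of_nat_mult of_nat_numeral)
    moreover have "0 \<le> s * (card U * (card U + 1) / 2)" using \<open>0 \<le> s\<close> by simp
    ultimately have "2 * g U \<le> (card U)\<^sup>2" by (simp add: g_def)
    moreover have "e V = edges K" using E by (auto simp: e_def nsets_def)
    then have "(s + \<epsilon>) * n\<^sup>2 / 2 - s * (n * (n + 1) / 2) \<le> g V"
      using dense n by (simp add: g_def V_def)
    moreover have "g V \<le> g U" using max by blast
    ultimately show ?thesis by (simp add: power2_eq_square field_simps)
  qed
  ultimately show ?thesis using that U by (simp add: V_def)
qed

text \<open>
  With \<open>s\<close> above \<open>1 - 1 / r\<close>, the vertices of the subset \<open>U\<close> have at most
  \<open>(1 - s) * |U|\<close> non-neighbours in \<open>U\<close>, and \<open>r * (1 - s) < 1\<close> allows \<open>r + 1\<close> parts.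
\<close>

theorem erdos_stone:
  fixes \<epsilon> :: real
  assumes r: "1 \<le> r" and \<epsilon>: "0 < \<epsilon>"
  shows "\<exists>n0. \<forall>K :: 'a graph. simple_graph K \<longrightarrow> n0 \<le> card (verts K) \<longrightarrow>
           (1 - 1 / r + \<epsilon>) * (card (verts K))\<^sup>2 / 2 \<le> card (edges K) \<longrightarrow>
           (\<exists>P. multipartite_in K (Suc r) t P)"
proof -
  \<comment> \<open>The minimum with \<open>1 / r\<close> keeps \<open>s \<le> 1\<close>, so that \<open>a\<close> is non-negative.\<close>
  define s where "s = 1 - 1 / r + min (\<epsilon> / 2) (1 / r)"
  define a where "a = 1 - s"
  have ra: "0 \<le> a" "r * a < 1" and s: "0 < s" "s + \<epsilon> / 2 \<le> 1 - 1 / r + \<epsilon>"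
  proof -
    define q where "q = 1 / real r"
    have q: "0 < q" "q \<le> 1" "r * q = 1" using r by (auto simp: q_def)
    have "r * min (\<epsilon> / 2) q > 0" using r \<epsilon> q by simp
    then show "r * a < 1" using q by (simp add: a_def s_def algebra_simps flip: q_def)
    show "0 \<le> a" using q \<epsilon> unfolding a_def s_def q_def[symmetric] by linarith
    show "0 < s" using q \<epsilon> unfolding s_def q_def[symmetric] by linarith
    show "s + \<epsilon> / 2 \<le> 1 - 1 / r + \<epsilon>" unfolding s_def q_def[symmetric] by linarith
  qed
  have "\<forall>i<Suc r. real i * a < 1"
  proof (intro allI impI)
    fix i assume "i < Suc r"
    then have "i * a \<le> r * a" using ra by (intro mult_right_mono) auto
    then show "i * a < 1" using ra by simp
  qed
  from multipartite_of_few_non_neighbours[OF ra(1) this, where t = t]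
  obtain n1 where n1: "\<forall>K :: 'a graph. finite (verts K) \<longrightarrow> n1 \<le> card (verts K) \<longrightarrow>
      (\<forall>x\<in>verts K. real (card {v \<in> verts K. {v, x} \<notin> edges K}) \<le> a * card (verts K)) \<longrightarrow>
      (\<exists>P. multipartite_in K (Suc r) t P)"
    by blast
  define n0 where "n0 = nat \<lceil>(real n1 ^ 2 + s) / (\<epsilon> / 2)\<rceil> + 1"
  show ?thesis
  proof (intro exI[of _ n0] allI impI)
    fix K :: "'a graph" assume K: "simple_graph K" and large: "n0 \<le> card (verts K)"
      and dense: "(1 - 1 / r + \<epsilon>) * (card (verts K))\<^sup>2 / 2 \<le> card (edges K)"
    define n where "n = card (verts K)"
    have "(s + \<epsilon> / 2) * n\<^sup>2 / 2 \<le> (1 - 1 / r + \<epsilon>) * n\<^sup>2 / 2"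
      using s by (intro divide_right_mono mult_right_mono) auto
    then obtain U where U: "U \<subseteq> verts K" and big: "\<epsilon> / 2 * n\<^sup>2 - s * n \<le> (card U)\<^sup>2"
      and deg: "\<forall>v\<in>U. s * card U \<le> card {w \<in> U. {v, w} \<in> edges K}"
      using dense_subset_with_min_degree[OF K n_def, of s "\<epsilon> / 2"] s dense
      by (auto simp: n_def)
    have finU: "finite U" using K U finite_subset by (auto simp: simple_graph_def)
    have "(real n1 ^ 2 + s) / (\<epsilon> / 2) \<le> n" "1 \<le> n"
      using large by (auto simp: n_def n0_def) linarith
    then have "real n1 ^ 2 + s \<le> \<epsilon> / 2 * n" "1 \<le> real n" using \<epsilon> by (auto simp: field_simps)
    then have "(real n1 ^ 2) * n \<le> (\<epsilon> / 2 * n - s) * n"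
      by (intro mult_right_mono) auto
    moreover have "real n1 ^ 2 * 1 \<le> (real n1 ^ 2) * n"
      using \<open>1 \<le> real n\<close> by (intro mult_left_mono) auto
    ultimately have "real n1 ^ 2 \<le> real (card U) ^ 2"
      using big by (simp add: power2_eq_square algebra_simps)
    then have "n1 \<le> card U" by (simp add: power2_le_iff_abs_le flip: of_nat_power)
    moreover have "real (card {v \<in> U. {v, x} \<notin> edges K}) \<le> a * card U" if "x \<in> U" for x
    proof -
      have "{v \<in> U. {v, x} \<notin> edges K} = U - {w \<in> U. {x, w} \<in> edges K}"
        by (auto simp: insert_commute)
      moreover have "card {w \<in> U. {x, w} \<in> edges K} \<le> card U" using finU by (auto intro: card_mono)
      ultimately have "real (card {v \<in> U. {v, x} \<notin> edges K})
          = card U - real (card {w \<in> U. {x, w} \<in> edges K})"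
        using finU by (simp add: card_Diff_subset of_nat_diff)
      then show ?thesis using bspec[OF deg that] by (simp add: a_def algebra_simps)
    qed
    ultimately obtain P where "multipartite_in (U, edges K) (Suc r) t P"
      using n1[rule_format, of "(U, edges K)"] finU by auto
    then have "multipartite_in K (Suc r) t P" using U by (auto simp: multipartite_in_def)
    then show "\<exists>P. multipartite_in K (Suc r) t P" by blast
  qed
qed

section \<open>A counting lemma for choice functions\<close>

text \<open>
  For each \<open>w\<close>, once the values elsewhere are fixed, at most \<open>d\<close> of the \<open>m\<close> possible values at \<open>w\<close>
  are forbidden. So a proportion of at most \<open>d / m\<close> of all choices is bad at \<open>w\<close>, and the choices
  that are bad somewhere do not exhaust all of them. Choosing the values greedily would not work, since
  a value at \<open>w\<close> may be forbidden by values that are chosen later.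
\<close>

lemma choose_avoiding:
  assumes fin: "finite V" and A: "\<And>v. v \<in> V \<Longrightarrow> card (A v) = m"
    and Fb: "\<And>w s. w \<in> V \<Longrightarrow> finite (Fb w s) \<and> card (Fb w s) \<le> d"
    and dep: "\<And>w s x. w \<in> V \<Longrightarrow> Fb w (s(w := x)) = Fb w s"
    and large: "card V * d < m"
  obtains s where "s \<in> PiE V A" "\<forall>w\<in>V. s w \<notin> Fb w s"
proof -
  define bad where "bad w = {s \<in> PiE V A. s w \<in> Fb w s}" for w
  have finA: "finite (A v)" if "v \<in> V" for v
    using A[OF that] large by (metis card.infinite not_less_zero)
  have card_bad: "card (bad w) \<le> d * m ^ (card V - 1)" if w: "w \<in> V" for w
  proof -
    let ?S = "Sigma (PiE (V - {w}) A) (Fb w)"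
    have finPi: "finite (PiE (V - {w}) A)" using fin finA by (auto intro!: finite_PiE)
    \<comment> \<open>A bad choice is determined by its values away from \<open>w\<close> together with a forbidden value at \<open>w\<close>.\<close>
    have "bad w \<subseteq> (\<lambda>(s, x). s(w := x)) ` ?S"
    proof
      fix s assume s: "s \<in> bad w"
      have "s(w := undefined) \<in> PiE (V - {w}) A"
        using s by (auto simp: bad_def PiE_iff extensional_def)
      moreover have "s w \<in> Fb w (s(w := undefined))" using s dep[OF w] by (simp add: bad_def)
      ultimately show "s \<in> (\<lambda>(s, x). s(w := x)) ` ?S"
        by (intro image_eqI[of _ _ "(s(w := undefined), s w)"]) auto
    qed
    then have "card (bad w) \<le> card ?S"
      using finPi Fb[OF w] by (intro surj_card_le) auto
    also have "\<dots> = (\<Sum>s\<in>PiE (V - {w}) A. card (Fb w s))"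
      using finPi Fb[OF w] by (intro card_SigmaI) auto
    also have "\<dots> \<le> card (PiE (V - {w}) A) * d"
      using Fb[OF w] sum_bounded_above[of "PiE (V - {w}) A" "\<lambda>s. card (Fb w s)" d] by simp
    also have "card (PiE (V - {w}) A) = m ^ (card V - 1)"
      using fin w A by (simp add: card_PiE)
    finally show ?thesis by (simp add: mult.commute)
  qed
  have "card (\<Union>w\<in>V. bad w) < card (PiE V A)"
  proof (cases "V = {}")
    case False
    then have V: "0 < card V" using fin by (simp add: card_gt_0_iff)
    have "card (\<Union>w\<in>V. bad w) \<le> (\<Sum>w\<in>V. card (bad w))" using fin by (rule card_UN_le)
    also have "\<dots> \<le> card V * (d * m ^ (card V - 1))"
      using sum_bounded_above[of V "\<lambda>w. card (bad w)"] card_bad by simp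
    also have "\<dots> = card V * d * m ^ (card V - 1)" by simp
    also have "\<dots> < m * m ^ (card V - 1)" using large by (intro mult_strict_right_mono) auto
    also have "\<dots> = m ^ card V" using V by (simp add: power_eq_if)
    also have "\<dots> = card (PiE V A)" using fin A by (simp add: card_PiE)
    finally show ?thesis .
  qed simp
  moreover have "finite (bad w)" if "w \<in> V" for w
    using finite_PiE[OF fin finA] by (simp add: bad_def)
  then have "finite (\<Union>w\<in>V. bad w)" using fin by blast
  ultimately have "\<not> PiE V A \<subseteq> (\<Union>w\<in>V. bad w)"
    using card_mono by (meson linorder_not_less)
  then show ?thesis using that by (auto simp: bad_def)
qed

section \<open>Hereditary families\<close>

definition map_graph :: "('a \<Rightarrow> 'b) \<Rightarrow> 'a graph \<Rightarrow> 'b graph" where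
  "map_graph \<phi> H = (\<phi> ` verts H, (\<lambda>e. \<phi> ` e) ` edges H)"

lemma simple_graph_map_graph:
  assumes "simple_graph H" "inj_on \<phi> (verts H)"
  shows "simple_graph (map_graph \<phi> H)"
proof -
  have "card (\<phi> ` e) = 2" if "e \<in> edges H" for e
    using assms that by (auto simp: simple_graph_def nsets_def
        intro!: trans[OF card_image] inj_on_subset[of \<phi> "verts H"])
  then show ?thesis
    using assms by (fastforce simp: simple_graph_def map_graph_def nsets_def)
qed

lemma graph_iso_map_graph: "inj_on \<phi> (verts H) \<Longrightarrow> graph_iso H (map_graph \<phi> H)"
  unfolding graph_iso_def map_graph_def by (intro exI[of _ \<phi>]) (simp add: bij_betw_def)

lemma hereditary_map_graph:
  assumes "hereditary F" "H \<in> F" "inj_on \<phi> (verts H)"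
  shows "map_graph \<phi> H \<in> F"
  using assms simple_graph_map_graph graph_iso_map_graph unfolding hereditary_def by metis

lemma hereditary_fewer_edges:
  assumes F: "hereditary F" and "H \<in> F" "simple_graph H'" "edges H' \<subseteq> edges H"
  shows "H' \<in> F"
proof -
  have "simple_graph H" using F \<open>H \<in> F\<close> by (simp add: hereditary_def)
  then have "subgraph (verts H, edges H') H"
    using assms by (auto simp: subgraph_def simple_graph_def)
  then have "(verts H, edges H') \<in> F" using F \<open>H \<in> F\<close> unfolding hereditary_def by blast
  moreover have "edges H' = edges (verts H, edges H')" by simp
  ultimately show ?thesis using F \<open>simple_graph H'\<close> unfolding hereditary_def by blast
qed

lemma hereditary_single_edge:
  assumes F: "hereditary F" "complete_graph 2 \<in> F" and H: "simple_graph H" "edges H \<subseteq> {e}"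
  shows "H \<in> F"
proof (cases "edges H = {}")
  case True
  then show ?thesis using F H unfolding hereditary_def by blast
next
  case False
  then have e: "e \<in> edges H" using H by auto
  then obtain x y where xy: "e = {x, y}" "x \<noteq> y"
    using H(1) by (auto simp: simple_graph_def elim!: nsets2_E)
  define \<phi> where "\<phi> i = (if i = 0 then x else y)" for i :: nat
  have "inj_on \<phi> (verts (complete_graph 2))"
    using xy by (auto simp: inj_on_def \<phi>_def complete_graph_def less_2_cases_iff)
  then have "map_graph \<phi> (complete_graph 2) \<in> F" using F hereditary_map_graph by blast
  moreover have "edges (map_graph \<phi> (complete_graph 2)) = {e}"
    using xy by (auto simp: map_graph_def complete_graph_def \<phi>_def lessThan_nat_numeral lessThan_Suc)
  ultimately show ?thesis using hereditary_fewer_edges F(1) H by metis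
qed

section \<open>From a rainbow multipartite graph to a copy\<close>

definition good_copy :: "nat graph \<Rightarrow> nat graph set \<Rightarrow> nat \<Rightarrow> (nat set \<Rightarrow> nat) \<Rightarrow> bool" where
  "good_copy G F n c \<longleftrightarrow>
     (\<exists>H. is_copy_in H G (complete_graph n) \<and> (\<forall>i. color_class c H i \<in> F))"

text \<open>
  The vertices of \<open>G\<close> are mapped into the parts according to the coloring \<open>\<kappa>\<close> of \<open>G - D\<close>. Edges of
  \<open>G\<close> between different parts then land in \<open>R\<close>, so they receive pairwise different colors, whereas edges
  inside a part belong to \<open>D\<close> and have arbitrary colors. If no edge of the first kind shares its color with
  one of the second kind, every color class is a single edge or a subgraph of \<open>D\<close>, hence a member
  of \<open>F\<close>.

  To avoid such coincidences, note that a pair of vertices has at most one twin, that is, an edge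
  of \<open>R\<close> with the same color. If \<open>{u, v}\<close> is mapped inside a part and the twin of its image is the
  image of an edge between two parts, this edge has an endpoint \<open>w\<close> outside \<open>{u, v}\<close>.
  So it suffices that the image of \<open>w\<close> avoids, for
  all \<open>u\<close> and \<open>v\<close>, the at most two vertices of the twin, as well as the images of the other vertices,
  which makes the map injective. \<open>choose_avoiding\<close> provides such a map.
\<close>

lemma good_copy_if_rainbow_multipartite:
  assumes G: "simple_graph G" and F: "hereditary F" "complete_graph 2 \<in> F"
    and D: "subgraph D G" "D \<in> F" and \<kappa>: "proper_coloring (delete_edges G D) k \<kappa>"
    and R: "R \<subseteq> nsets {..<n} 2" "inj_on c R"
    and P: "multipartite_in ({..<n}, R) k T P"
    and T: "card (verts G) * (card (verts G) + (card (verts G))\<^sup>2 * 2) < T"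
  shows "good_copy G F n c"
proof -
  define V where "V = verts G"
  have finV: "finite V" and EV: "edges G \<subseteq> nsets V 2" using G by (auto simp: simple_graph_def V_def)
  have finR: "finite R" using R finite_imp_finite_nsets[of "{..<n}" 2] finite_subset by blast
  \<comment> \<open>At most one edge \<open>f\<close> has the same color as \<open>e\<close>, so the union is that edge or empty.\<close>
  define twins where "twins e = \<Union> {f \<in> R. c f = c e}" for e
  have twins: "finite (twins e) \<and> card (twins e) \<le> 2" for e
  proof (cases "\<exists>f\<in>R. c f = c e")
    case True
    then obtain f where f: "f \<in> R" "c f = c e" by blast
    then have "{f \<in> R. c f = c e} = {f}" using R(2) by (auto simp: inj_on_def)
    then have "twins e = f" by (simp add: twins_def)
    then show ?thesis using f R(1) by (auto simp: nsets_def)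
  next
    case False
    then have "{f \<in> R. c f = c e} = {}" by blast
    then show ?thesis by (simp only: twins_def) simp
  qed
  define Fb where "Fb w s = s ` (V - {w}) \<union> (\<Union>(u, v)\<in>(V - {w}) \<times> (V - {w}). twins {s u, s v})"
    for w and s :: "nat \<Rightarrow> nat"
  have Fb: "finite (Fb w s) \<and> card (Fb w s) \<le> card V + (card V)\<^sup>2 * 2" if w: "w \<in> V" for w s
  proof
    let ?I = "(V - {w}) \<times> (V - {w})"
    show "finite (Fb w s)" using finV twins by (auto simp: Fb_def)
    have "card (\<Union>(u, v)\<in>?I. twins {s u, s v}) \<le> (\<Sum>(u, v)\<in>?I. card (twins {s u, s v}))"
      using card_UN_le[of ?I "\<lambda>(u, v). twins {s u, s v}"] finV by (simp add: case_prod_unfold)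
    also have "\<dots> \<le> (\<Sum>p\<in>?I. 2)" using twins by (intro sum_mono) auto
    also have "\<dots> = card ?I * 2" by simp
    also have "\<dots> \<le> (card V)\<^sup>2 * 2"
      using finV card_mono[of "V \<times> V" ?I] by (auto simp: card_cartesian_product power2_eq_square)
    finally have "card (\<Union>(u, v)\<in>?I. twins {s u, s v}) \<le> (card V)\<^sup>2 * 2" .
    moreover have "card (s ` (V - {w})) \<le> card V"
      using finV by (meson card_image_le card_mono Diff_subset finite_Diff order_trans)
    ultimately show "card (Fb w s) \<le> card V + (card V)\<^sup>2 * 2"
      unfolding Fb_def by (intro order_trans[OF card_Un_le] add_mono)
  qed
  have dep: "Fb w (s(w := x)) = Fb w s" for w s x
    unfolding Fb_def by (intro arg_cong2[where f = "(\<union>)"] image_cong SUP_cong) auto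
  have \<kappa>V: "\<kappa> v < k" if "v \<in> V" for v
    using \<kappa> that by (auto simp: proper_coloring_def delete_edges_def V_def)
  obtain s where s: "s \<in> (\<Pi>\<^sub>E v\<in>V. P (\<kappa> v))" and avoid: "\<forall>w\<in>V. s w \<notin> Fb w s"
  proof (rule choose_avoiding[OF finV _ Fb dep])
    show "card (P (\<kappa> v)) = T" if "v \<in> V" for v
      using P \<kappa>V[OF that] by (simp add: multipartite_in_def)
  qed (use T in \<open>simp_all add: V_def\<close>)
  have sP: "s v \<in> P (\<kappa> v)" if "v \<in> V" for v using s that by auto
  have inj: "inj_on s V"
  proof (rule inj_onI, rule ccontr)
    fix u v assume uv: "u \<in> V" "v \<in> V" "s u = s v" "u \<noteq> v"
    then have "s v \<in> s ` (V - {v})" by (intro image_eqI[of _ _ u]) auto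
    then have "s v \<in> Fb v s" by (simp add: Fb_def)
    then show False using avoid uv by blast
  qed
  define H where "H = map_graph s G"
  have sH: "simple_graph H" using simple_graph_map_graph[OF G, of s] inj by (simp add: H_def V_def)
  have "verts H \<subseteq> {..<n}" using sP \<kappa>V P by (fastforce simp: H_def map_graph_def multipartite_in_def V_def)
  moreover have "edges H \<subseteq> nsets {..<n} 2"
    using sH nsets_mono[OF \<open>verts H \<subseteq> {..<n}\<close>, of 2] by (auto simp: simple_graph_def)
  ultimately have "subgraph H (complete_graph n)"
    using sH by (auto simp: subgraph_def complete_graph_def simple_graph_def)
  then have "is_copy_in H G (complete_graph n)"
    using graph_iso_map_graph[of s G] inj by (simp add: is_copy_in_def H_def V_def)
  moreover have "color_class c H i \<in> F" for i
  proof -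
    have sC: "simple_graph (color_class c H i)"
      using sH by (auto simp: simple_graph_def color_class_def)
    have crossing: "s ` {u, v} \<in> R" if "{u, v} \<in> edges G" "\<kappa> u \<noteq> \<kappa> v" for u v
    proof -
      have "u \<in> V" "v \<in> V" using that(1) EV by auto
      then have "s u \<in> P (\<kappa> u)" "s v \<in> P (\<kappa> v)" "\<kappa> u < k" "\<kappa> v < k"
        using sP \<kappa>V by auto
      then show ?thesis using P that(2) by (simp add: multipartite_in_def)
    qed
    show ?thesis
    \<comment> \<open>Either the color occurs between two parts, and then only once in the copy,
      or it occurs only on edges coming from \<open>D\<close>.\<close>
    proof (cases "\<exists>w w'. {w, w'} \<in> edges G \<and> \<kappa> w \<noteq> \<kappa> w' \<and> c (s ` {w, w'}) = i")
      case True
      then obtain w w' where g: "{w, w'} \<in> edges G" "\<kappa> w \<noteq> \<kappa> w'" "c (s ` {w, w'}) = i" by blast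
      have gR: "s ` {w, w'} \<in> R" using crossing g by blast
      have "s ` e = s ` {w, w'}" if e: "e \<in> edges G" "c (s ` e) = i" for e
      proof -
        obtain u v where uv: "e = {u, v}" "u \<in> V" "v \<in> V" using e EV by (auto elim!: nsets2_E)
        show ?thesis
        proof (cases "\<kappa> u = \<kappa> v")
          case False
          then show ?thesis using crossing[of u v] e uv gR g(3) R(2) by (auto dest: inj_onD)
        next
          case True
          \<comment> \<open>The endpoint whose part differs from that of \<open>u\<close> and \<open>v\<close> was chosen to avoid this twin.\<close>
          have "\<exists>x\<in>{w, w'}. \<kappa> x \<noteq> \<kappa> u" using g(2) by auto
          then obtain x where x: "x \<in> {w, w'}" and "\<kappa> x \<noteq> \<kappa> u" by (elim bexE)
          then have xuv: "x \<noteq> u" "x \<noteq> v" using True by auto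
          have "x \<in> V" using x g(1) EV by auto
          have "s x \<in> twins {s u, s v}"
            using x gR g(3) e(2) uv(1) by (auto simp: twins_def intro!: exI[of _ "s ` {w, w'}"])
          moreover have "u \<in> V - {x}" "v \<in> V - {x}" using uv xuv by auto
          ultimately have "s x \<in> Fb x s" unfolding Fb_def by blast
          then show ?thesis using avoid \<open>x \<in> V\<close> by blast
        qed
      qed
      then have "edges (color_class c H i) \<subseteq> {s ` {w, w'}}"
        by (auto simp: color_class_def H_def map_graph_def)
      then show ?thesis using hereditary_single_edge F sC by blast
    next
      case False
      have "edges (color_class c H i) \<subseteq> edges (map_graph s (V, edges D))"
      proof
        fix f assume "f \<in> edges (color_class c H i)"
        then obtain e where e: "e \<in> edges G" "f = s ` e" "c (s ` e) = i"
          by (auto simp: color_class_def H_def map_graph_def)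
        obtain u v where uv: "e = {u, v}" using e EV by (auto elim!: nsets2_E)
        then have "\<kappa> u = \<kappa> v" using False e by blast
        then have "e \<in> edges D"
          using \<kappa> e(1) uv by (auto simp: proper_coloring_def delete_edges_def)
        then show "f \<in> edges (map_graph s (V, edges D))" using e by (simp add: map_graph_def)
      qed
      moreover have "simple_graph (V, edges D)"
        using D(1) EV finV by (auto simp: subgraph_def simple_graph_def)
      then have "(V, edges D) \<in> F" using hereditary_fewer_edges[OF F(1) D(2)] by simp
      then have "map_graph s (V, edges D) \<in> F" using hereditary_map_graph[OF F(1)] inj by simp
      ultimately show ?thesis using hereditary_fewer_edges[OF F(1) _ sC] by blast
    qed
  qed
  ultimately show ?thesis unfolding good_copy_def by blast
qed

section \<open>The color threshold and the reduced chromatic number\<close>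

lemma color_threshold_good_copy:
  "color_threshold n G F = (LEAST k. 0 < k \<and>
     (\<forall>c. k \<le> card (c ` edges (complete_graph n)) \<longrightarrow> good_copy G F n c))"
  by (simp add: color_threshold_def good_copy_def)

lemma color_threshold_le:
  assumes "0 < k" "\<And>c. k \<le> card (c ` edges (complete_graph n)) \<Longrightarrow> good_copy G F n c"
  shows "color_threshold n G F \<le> k"
  unfolding color_threshold_good_copy using assms by (intro Least_le) auto

lemma card_colors_less_color_threshold:
  assumes "\<not> good_copy G F n c"
  shows "card (c ` edges (complete_graph n)) < color_threshold n G F"
proof -
  let ?ok = "\<lambda>k. 0 < k \<and> (\<forall>c. k \<le> card (c ` edges (complete_graph n)) \<longrightarrow> good_copy G F n c)"
  have "finite (edges (complete_graph n))"
    by (simp add: complete_graph_def finite_imp_finite_nsets)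
  then have "?ok (Suc (card (edges (complete_graph n))))"
    using card_image_le by (metis Suc_le_eq not_less zero_less_Suc)
  then have "?ok (color_threshold n G F)" unfolding color_threshold_good_copy by (rule LeastI)
  then show ?thesis using assms by (meson not_less)
qed

lemma proper_coloring_chromatic_number:
  assumes "simple_graph G"
  obtains c where "proper_coloring G (chromatic_number G) c"
proof -
  obtain f and N :: nat where f: "f ` verts G = {i. i < N}" "inj_on f (verts G)"
    using assms finite_imp_inj_to_nat_seg by (metis simple_graph_def)
  have "f u \<noteq> f v" if "{u, v} \<in> edges G" for u v
  proof -
    have "{u, v} \<in> nsets (verts G) 2" using assms that unfolding simple_graph_def by blast
    then have "u \<in> verts G" "v \<in> verts G" "u \<noteq> v" unfolding doubleton_in_nsets_2 by auto
    then show ?thesis using f(2) by (auto dest: inj_onD)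
  qed
  then have "proper_coloring G N f" using f(1) by (auto simp: proper_coloring_def)
  then have "\<exists>k c. proper_coloring G k c" by blast
  then show ?thesis using that LeastI_ex[of "\<lambda>k. \<exists>c. proper_coloring G k c"]
    unfolding chromatic_number_def by blast
qed

lemma chromatic_number_le: "proper_coloring G k c \<Longrightarrow> chromatic_number G \<le> k"
  unfolding chromatic_number_def by (blast intro: Least_le)

lemma finite_deck: "simple_graph G \<Longrightarrow> finite (deck G F)"
  by (rule finite_subset[of _ "{verts G} \<times> Pow (edges G)"])
    (auto simp: deck_def delete_edges_def finite_edges)

lemma reduced_chromatic_number_le:
  assumes "simple_graph G" "subgraph D G" "D \<in> F" "proper_coloring (delete_edges G D) k c"
  shows "reduced_chromatic_number F G \<le> k"
proof -
  have "delete_edges G D \<in> deck G F" using assms unfolding deck_def by blast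
  then have "reduced_chromatic_number F G \<le> chromatic_number (delete_edges G D)"
    unfolding reduced_chromatic_number_def using assms finite_deck[of G F]
    by (intro Min_le) auto
  then show ?thesis using chromatic_number_le[OF assms(4)] by linarith
qed

lemma reduced_chromatic_number_attained:
  assumes G: "simple_graph G" and F: "hereditary F"
  obtains D c where "subgraph D G" "D \<in> F"
    "proper_coloring (delete_edges G D) (reduced_chromatic_number F G) c"
proof -
  have "simple_graph (verts G, {})" using G by (simp add: simple_graph_def)
  then have "subgraph (verts G, {}) G" "(verts G, {}) \<in> F"
    using F G by (auto simp: subgraph_def hereditary_def)
  then have "deck G F \<noteq> {}" unfolding deck_def by blast
  then have "reduced_chromatic_number F G \<in> chromatic_number ` deck G F"
    unfolding reduced_chromatic_number_def using finite_deck[OF G] by (intro Min_in) auto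
  then obtain D where D: "subgraph D G" "D \<in> F"
    and eq: "reduced_chromatic_number F G = chromatic_number (delete_edges G D)"
    unfolding deck_def by blast
  have "simple_graph (delete_edges G D)"
    using G by (auto simp: simple_graph_def delete_edges_def)
  then show ?thesis using that D eq proper_coloring_chromatic_number by metis
qed

text \<open>
  Choose one edge of each color. This gives a rainbow graph with as many edges as there are colors, to
  which the Erdos-Stone theorem applies; the parts it yields are large enough for
  \<open>good_copy_if_rainbow_multipartite\<close>.
\<close>

lemma color_threshold_upper:
  fixes \<epsilon> :: real
  assumes G: "simple_graph G" and F: "hereditary F" "complete_graph 2 \<in> F"
    and r: "reduced_chromatic_number F G = Suc r" "1 \<le> r" and \<epsilon>: "0 < \<epsilon>"
  shows "\<forall>\<^sub>F n in at_top. real (color_threshold n G F) \<le> (1 - 1 / r + \<epsilon>) * n\<^sup>2 / 2 + 1"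
proof -
  obtain D \<kappa> where D: "subgraph D G" "D \<in> F" and \<kappa>: "proper_coloring (delete_edges G D) (Suc r) \<kappa>"
    using reduced_chromatic_number_attained[OF G F(1)] r by metis
  define T where "T = Suc (card (verts G) * (card (verts G) + (card (verts G))\<^sup>2 * 2))"
  obtain n0 where n0: "\<forall>K :: nat graph. simple_graph K \<longrightarrow> n0 \<le> card (verts K) \<longrightarrow>
      (1 - 1 / r + \<epsilon>) * (card (verts K))\<^sup>2 / 2 \<le> card (edges K) \<longrightarrow>
      (\<exists>P. multipartite_in K (Suc r) T P)"
    using erdos_stone[OF r(2) \<epsilon>, of T] by blast
  have "real (color_threshold n G F) \<le> (1 - 1 / r + \<epsilon>) * n\<^sup>2 / 2 + 1" if n: "max n0 1 \<le> n" for n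
  proof -
    define x where "x = (1 - 1 / r + \<epsilon>) * n\<^sup>2 / 2"
    have "0 \<le> 1 - 1 / real r" using r(2) by simp
    then have "0 < 1 - 1 / r + \<epsilon>" using \<epsilon> by linarith
    then have x: "0 < x" using n by (simp add: x_def)
    have "color_threshold n G F \<le> nat \<lceil>x\<rceil>"
    proof (rule color_threshold_le)
      show "0 < nat \<lceil>x\<rceil>" using x by simp
      fix c :: "nat set \<Rightarrow> nat"
      assume colors: "nat \<lceil>x\<rceil> \<le> card (c ` edges (complete_graph n))"
      obtain R where R: "R \<subseteq> nsets {..<n} 2" "inj_on c R" "c ` nsets {..<n} 2 = c ` R"
        using subset_image_inj[of "c ` nsets {..<n} 2" c "nsets {..<n} 2"] by auto
      have "card R = card (c ` edges (complete_graph n))"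
        using R by (simp add: complete_graph_def card_image)
      then have "x \<le> card R" using colors by linarith
      moreover have "simple_graph ({..<n}, R)" using R by (simp add: simple_graph_def)
      ultimately obtain P where P: "multipartite_in ({..<n}, R) (Suc r) T P"
        using n0[rule_format, of "({..<n}, R)"] n by (auto simp: x_def)
      show "good_copy G F n c"
        by (rule good_copy_if_rainbow_multipartite[OF G F D \<kappa> R(1,2) P]) (simp add: T_def)
    qed
    then have "real (color_threshold n G F) \<le> x + 1" using x by linarith
    then show ?thesis by (simp add: x_def)
  qed
  then show ?thesis unfolding eventually_at_top_linorder by blast
qed

section \<open>Lower bounds from Turan graphs\<close>

text \<open>
  The balanced complete \<open>r\<close>-partite graph, whose parts are the residue classes modulo \<open>r\<close>.
\<close>

definition turan_graph :: "nat \<Rightarrow> nat \<Rightarrow> nat graph" where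
  "turan_graph r n = ({..<n}, {e. \<exists>u v. e = {u, v} \<and> u < n \<and> v < n \<and> u mod r \<noteq> v mod r})"

lemma simple_turan_graph: "simple_graph (turan_graph r n)"
  by (auto simp: simple_graph_def turan_graph_def)

lemma turan_graph_colored: "{u, v} \<in> edges (turan_graph r n) \<Longrightarrow> u mod r \<noteq> v mod r"
  by (auto simp: turan_graph_def doubleton_eq_iff)

text \<open>
  The vertex \<open>n\<close> is adjacent to all but at most \<open>n / r\<close> of the \<open>n\<close> smaller ones. Summing these
  contributions yields the bound without computing the sizes of the parts.
\<close>

lemma card_edges_turan_graph:
  assumes r: "1 \<le> r"
  shows "(1 - 1 / r) * (real n * (real n - 1)) / 2 \<le> card (edges (turan_graph r n))"
proof (induction n)
  case (Suc n)
  let ?N = "{u. u < n \<and> u mod r \<noteq> n mod r}"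
  let ?M = "{u. u < n \<and> u mod r = n mod r}"
  have "card ?M \<le> n div r"
  proof -
    have "inj_on (\<lambda>u. u div r) ?M" by (auto simp: inj_on_def) (metis div_mult_mod_eq)
    moreover have "(\<lambda>u. u div r) ` ?M \<subseteq> {..<n div r}"
    proof clarsimp
      fix u assume u: "u < n" "u mod r = n mod r"
      then have "u div r \<noteq> n div r" by (metis div_mult_mod_eq less_irrefl)
      moreover have "u div r \<le> n div r" using u by (intro div_le_mono) simp
      ultimately show "u div r < n div r" by simp
    qed
    ultimately show ?thesis using card_inj_on_le[of "\<lambda>u. u div r" ?M "{..<n div r}"] by simp
  qed
  then have M: "real (card ?M) \<le> n / r"
    using of_nat_div_le_of_nat[of n r, where 'a = real] by (meson of_nat_le_iff order_trans)
  have "card ?N + card ?M = card (?N \<union> ?M)" by (subst card_Un_disjoint) auto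
  also have "?N \<union> ?M = {..<n}" by auto
  finally have N: "real (card ?N) = n - real (card ?M)" by simp
  have "edges (turan_graph r n) \<union> (\<lambda>u. {u, n}) ` ?N \<subseteq> edges (turan_graph r (Suc n))"
  proof
    fix e assume "e \<in> edges (turan_graph r n) \<union> (\<lambda>u. {u, n}) ` ?N"
    then have "\<exists>u v. e = {u, v} \<and> u < Suc n \<and> v < Suc n \<and> u mod r \<noteq> v mod r"
    proof
      assume "e \<in> edges (turan_graph r n)"
      then obtain u v where "e = {u, v}" "u < n" "v < n" "u mod r \<noteq> v mod r"
        by (auto simp: turan_graph_def)
      then show ?thesis by (intro exI[of _ u] exI[of _ v]) simp
    next
      assume "e \<in> (\<lambda>u. {u, n}) ` ?N"
      then obtain u where "e = {u, n}" "u < n" "u mod r \<noteq> n mod r" by auto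
      then show ?thesis by (intro exI[of _ u] exI[of _ n]) simp
    qed
    then show "e \<in> edges (turan_graph r (Suc n))" by (simp add: turan_graph_def)
  qed
  then have "card (edges (turan_graph r n) \<union> (\<lambda>u. {u, n}) ` ?N) \<le> card (edges (turan_graph r (Suc n)))"
    by (intro card_mono finite_edges simple_turan_graph)
  moreover have "card (edges (turan_graph r n) \<union> (\<lambda>u. {u, n}) ` ?N)
      = card (edges (turan_graph r n)) + card ((\<lambda>u. {u, n}) ` ?N)"
    by (intro card_Un_disjoint finite_edges simple_turan_graph)
      (auto simp: turan_graph_def doubleton_eq_iff)
  moreover have "card ((\<lambda>u. {u, n}) ` ?N) = card ?N"
    by (intro card_image) (auto simp: inj_on_def doubleton_eq_iff)
  ultimately have "real (card (edges (turan_graph r n))) + (n - n / r) \<le> card (edges (turan_graph r (Suc n)))"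
    using N M by linarith
  moreover have "(1 - 1 / r) * (real (Suc n) * (real (Suc n) - 1)) / 2
      = (1 - 1 / r) * (real n * (real n - 1)) / 2 + (n - n / r)"
    using r by (simp add: field_simps)
  ultimately show ?case using Suc.IH by linarith
qed simp

text \<open>
  Color the edges of the Turan graph with pairwise different colors and all other edges with one further
  color \<open>0\<close>. In a copy of \<open>G\<close> whose color classes belong to \<open>F\<close>, deleting the class of color \<open>0\<close>
  leaves a subgraph of the Turan graph, which is \<open>r\<close>-colorable. Pulled back to \<open>G\<close>, this contradicts
  that the reduced chromatic number exceeds \<open>r\<close>.
\<close>

lemma color_threshold_lower:
  assumes G: "simple_graph G" and F: "hereditary F"
    and r: "1 \<le> r" "r < reduced_chromatic_number F G"
  shows "card (edges (turan_graph r n)) \<le> color_threshold n G F"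
proof -
  let ?T = "edges (turan_graph r n)"
  obtain idx :: "nat set \<Rightarrow> nat" where idx: "inj_on idx ?T"
    using finite_imp_inj_to_nat_seg[OF finite_edges[OF simple_turan_graph]] by metis
  define c where "c e = (if e \<in> ?T then Suc (idx e) else 0)" for e
  have sub: "?T \<subseteq> edges (complete_graph n)"
    using simple_turan_graph[of r n] by (simp add: simple_graph_def turan_graph_def complete_graph_def)
  have "\<not> good_copy G F n c"
  proof
    assume "good_copy G F n c"
    then obtain H where copy: "is_copy_in H G (complete_graph n)" and cls: "color_class c H 0 \<in> F"
      unfolding good_copy_def by blast
    have "graph_iso G H" using copy by (simp add: is_copy_in_def)
    then obtain \<phi> where \<phi>: "bij_betw \<phi> (verts G) (verts H)" "edges H = (\<lambda>e. \<phi> ` e) ` edges G"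
      unfolding graph_iso_def by (elim exE conjE)
    define \<psi> where "\<psi> = inv_into (verts G) \<phi>"
    define D where "D = map_graph \<psi> (color_class c H 0)"
    have \<psi>: "inj_on \<psi> (verts H)" "\<psi> ` verts H = verts G"
      using bij_betw_inv_into[OF \<phi>(1)] by (auto simp: \<psi>_def bij_betw_def)
    have pull: "\<psi> ` \<phi> ` e = e" if "e \<in> edges G" for e
    proof -
      have "e \<subseteq> verts G" using G that by (auto simp: simple_graph_def nsets_def)
      then show ?thesis using \<phi>(1) by (simp add: \<psi>_def bij_betw_def)
    qed
    have "D \<in> F" unfolding D_def
      using hereditary_map_graph[OF F cls] \<psi> by (simp add: color_class_def)
    moreover have "subgraph D G"
    proof -
      have "simple_graph D" using \<open>D \<in> F\<close> F by (simp add: hereditary_def)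
      then show ?thesis
        using G \<psi> \<phi>(2) pull by (auto simp: subgraph_def D_def map_graph_def color_class_def)
    qed
    moreover have "proper_coloring (delete_edges G D) r (\<lambda>v. \<phi> v mod r)"
      unfolding proper_coloring_def
    proof (intro conjI allI impI)
      show "(\<lambda>v. \<phi> v mod r) ` verts (delete_edges G D) \<subseteq> {..<r}" using r(1) by auto
      fix u v assume "{u, v} \<in> edges (delete_edges G D)"
      then have e: "{u, v} \<in> edges G" "{u, v} \<notin> edges D" by (auto simp: delete_edges_def)
      have "\<phi> ` {u, v} \<in> ?T"
      proof (rule ccontr)
        assume "\<phi> ` {u, v} \<notin> ?T"
        moreover have "\<phi> ` {u, v} \<in> edges H" unfolding \<phi>(2) using e(1) by (rule imageI)
        ultimately have "\<phi> ` {u, v} \<in> edges (color_class c H 0)"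
          by (simp add: color_class_def c_def)
        then have "\<psi> ` \<phi> ` {u, v} \<in> edges D" unfolding D_def map_graph_def snd_conv by (rule imageI)
        then show False using pull[OF e(1)] e(2) by simp
      qed
      then show "\<phi> u mod r \<noteq> \<phi> v mod r" using turan_graph_colored by simp
    qed
    ultimately have "reduced_chromatic_number F G \<le> r"
      using reduced_chromatic_number_le[OF G] by blast
    then show False using r by simp
  qed
  then have "card (c ` edges (complete_graph n)) < color_threshold n G F"
    by (rule card_colors_less_color_threshold)
  moreover have "card ?T = card (c ` ?T)"
    using idx by (intro card_image[symmetric]) (auto simp: inj_on_def c_def)
  moreover have "card (c ` ?T) \<le> card (c ` edges (complete_graph n))"
    using sub by (intro card_mono image_mono finite_imageI)
      (simp_all add: complete_graph_def finite_imp_finite_nsets)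
  ultimately show ?thesis by linarith
qed

section \<open>Turan numbers of complete graphs\<close>

lemma turan_graph_no_complete_graph:
  assumes "1 \<le> r" "r < k"
  shows "\<not> is_copy_in H (complete_graph k) (turan_graph r n)"
proof
  assume "is_copy_in H (complete_graph k) (turan_graph r n)"
  then obtain \<phi> where H: "edges H \<subseteq> edges (turan_graph r n)"
    and \<phi>: "edges H = (\<lambda>e. \<phi> ` e) ` nsets {..<k} 2"
    by (auto simp: is_copy_in_def subgraph_def graph_iso_def complete_graph_def)
  have "inj_on (\<lambda>i. \<phi> i mod r) {..<k}"
  proof (rule inj_onI, rule ccontr)
    fix i j assume ij: "i \<in> {..<k}" "j \<in> {..<k}" "\<phi> i mod r = \<phi> j mod r" "i \<noteq> j"
    then have "{i, j} \<in> nsets {..<k} 2" by simp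
    then have "\<phi> ` {i, j} \<in> edges H" unfolding \<phi> by (rule imageI)
    then have "\<phi> ` {i, j} \<in> edges (turan_graph r n)" using H by (rule rev_subsetD)
    then show False using turan_graph_colored ij(3) by simp
  qed
  moreover have "(\<lambda>i. \<phi> i mod r) ` {..<k} \<subseteq> {..<r}" using assms by auto
  ultimately have "card {..<k} \<le> card {..<r}" by (intro card_inj_on_le) auto
  then show False using assms by simp
qed

lemma finite_turan_set:
  "finite {card (edges K) | K :: nat graph.
     simple_graph K \<and> card (verts K) = n \<and> \<not> (\<exists>H'. is_copy_in H' H K)}"
proof (rule finite_subset)
  show "{card (edges K) | K :: nat graph. simple_graph K \<and> card (verts K) = n \<and>
      \<not> (\<exists>H'. is_copy_in H' H K)} \<subseteq> {..n choose 2}"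
  proof
    fix m assume "m \<in> {card (edges K) | K :: nat graph. simple_graph K \<and> card (verts K) = n \<and>
      \<not> (\<exists>H'. is_copy_in H' H K)}"
    then obtain K :: "nat graph" where K: "simple_graph K" "card (verts K) = n" "m = card (edges K)"
      by blast
    then have "card (edges K) \<le> card (nsets (verts K) 2)"
      by (intro card_mono finite_imp_finite_nsets) (simp_all add: simple_graph_def)
    then show "m \<in> {..n choose 2}" using K by simp
  qed
qed simp

lemma turan_number_lower:
  assumes "1 \<le> r"
  shows "card (edges (turan_graph r n)) \<le> turan_number n (complete_graph (Suc r))"
  unfolding turan_number_def
proof (rule Max_ge[OF finite_turan_set])
  have "card (verts (turan_graph r n)) = n" by (simp add: turan_graph_def)
  then show "card (edges (turan_graph r n)) \<in> {card (edges K) | K :: nat graph.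
      simple_graph K \<and> card (verts K) = n \<and> \<not> (\<exists>H'. is_copy_in H' (complete_graph (Suc r)) K)}"
    using simple_turan_graph turan_graph_no_complete_graph[OF assms, of "Suc r"] by blast
qed

lemma complete_graph_in_multipartite:
  assumes K: "simple_graph K" and P: "multipartite_in K k 1 P"
  shows "\<exists>H. is_copy_in H (complete_graph k) K"
proof -
  have "\<exists>x. P i = {x}" if "i < k" for i
    using P that by (auto simp: multipartite_in_def card_1_singleton_iff)
  then obtain x where x: "\<And>i. i < k \<Longrightarrow> P i = {x i}" by metis
  have adj: "{x i, x j} \<in> edges K" if "i < k" "j < k" "i \<noteq> j" for i j
    using P x that by (simp add: multipartite_in_def)
  then have "{x i, x j} \<in> nsets (verts K) 2" if "i < k" "j < k" "i \<noteq> j" for i j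
    using K that unfolding simple_graph_def by blast
  then have inj: "inj_on x (verts (complete_graph k))"
    unfolding inj_on_def complete_graph_def doubleton_in_nsets_2 by auto
  define H where "H = map_graph x (complete_graph k)"
  have "simple_graph H"
    using simple_graph_map_graph[OF _ inj] by (simp add: H_def complete_graph_def simple_graph_def)
  moreover have "verts H \<subseteq> verts K"
    using P x by (auto simp: H_def map_graph_def complete_graph_def multipartite_in_def)
  moreover have "edges H \<subseteq> edges K"
    using adj by (auto simp: H_def map_graph_def complete_graph_def elim!: nsets2_E)
  ultimately show ?thesis
    using K graph_iso_map_graph[OF inj] unfolding is_copy_in_def subgraph_def H_def by blast
qed

text \<open>
  The Erdos-Stone theorem with parts of size one: a complete multipartite graph on \<open>r + 1\<close>
  singletons is a complete graph.
\<close>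

lemma turan_number_upper:
  fixes \<epsilon> :: real
  assumes r: "1 \<le> r" and \<epsilon>: "0 < \<epsilon>"
  shows "\<forall>\<^sub>F n in at_top. real (turan_number n (complete_graph (Suc r))) \<le> (1 - 1 / r + \<epsilon>) * n\<^sup>2 / 2"
proof -
  obtain n0 where n0: "\<forall>K :: nat graph. simple_graph K \<longrightarrow> n0 \<le> card (verts K) \<longrightarrow>
      (1 - 1 / r + \<epsilon>) * (card (verts K))\<^sup>2 / 2 \<le> card (edges K) \<longrightarrow>
      (\<exists>P. multipartite_in K (Suc r) 1 P)"
    using erdos_stone[OF r \<epsilon>, of 1] by blast
  have "real (turan_number n (complete_graph (Suc r))) \<le> (1 - 1 / r + \<epsilon>) * n\<^sup>2 / 2" if n: "n0 \<le> n" for n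
  proof -
    let ?S = "{card (edges K) | K :: nat graph. simple_graph K \<and> card (verts K) = n \<and>
      \<not> (\<exists>H'. is_copy_in H' (complete_graph (Suc r)) K)}"
    have "card (verts (turan_graph r n)) = n" by (simp add: turan_graph_def)
    then have "card (edges (turan_graph r n)) \<in> ?S"
      using simple_turan_graph turan_graph_no_complete_graph[OF r, of "Suc r"] by blast
    then have "Max ?S \<in> ?S" by (intro Max_in finite_turan_set) blast
    then obtain K :: "nat graph" where K: "simple_graph K" "card (verts K) = n"
      "\<not> (\<exists>H'. is_copy_in H' (complete_graph (Suc r)) K)"
      and max: "turan_number n (complete_graph (Suc r)) = card (edges K)"
      unfolding turan_number_def by blast
    have "\<nexists>P. multipartite_in K (Suc r) 1 P" using complete_graph_in_multipartite K by blast
    then have "\<not> (1 - 1 / r + \<epsilon>) * n\<^sup>2 / 2 \<le> card (edges K)"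
      using n0[rule_format, of K] K(1,2) n by blast
    then show ?thesis using max by simp
  qed
  then show ?thesis unfolding eventually_at_top_linorder by blast
qed

section \<open>Asymptotics\<close>

text \<open>
  The summand \<open>1\<close> leaves room for rounding a real bound up to an integer number of colors.
\<close>

lemma quadratic_limit:
  fixes g :: "nat \<Rightarrow> real"
  assumes lower: "\<And>n. L * (real n * (real n - 1)) / 2 \<le> g n"
    and upper: "\<And>\<epsilon>. 0 < \<epsilon> \<Longrightarrow> \<forall>\<^sub>F n in at_top. g n \<le> (L + \<epsilon>) * (real n)\<^sup>2 / 2 + 1"
  shows "(\<lambda>n. g n / real n ^ 2) \<longlonglongrightarrow> L / 2"
proof (rule order_tendstoI)
  fix a assume "a < L / 2"
  moreover have "(\<lambda>n. L / 2 - L / 2 * inverse (real n)) \<longlonglongrightarrow> L / 2 - L / 2 * 0"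
    by (intro tendsto_intros lim_inverse_n)
  ultimately have "\<forall>\<^sub>F n in at_top. a < L / 2 - L / 2 * inverse (real n)"
    by (intro order_tendstoD(1)) auto
  then show "\<forall>\<^sub>F n in at_top. a < g n / real n ^ 2"
    using eventually_gt_at_top[of 0]
  proof eventually_elim
    case (elim n)
    have "L / 2 - L / 2 * inverse (real n) = L * (real n * (real n - 1)) / 2 / real n ^ 2"
      using elim(2) by (simp add: field_simps power2_eq_square)
    also have "\<dots> \<le> g n / real n ^ 2" using lower by (intro divide_right_mono) auto
    finally show ?case using elim(1) by linarith
  qed
next
  fix a assume a: "L / 2 < a"
  define \<epsilon> where "\<epsilon> = a - L / 2"
  have \<epsilon>: "0 < \<epsilon>" using a by (simp add: \<epsilon>_def)
  have "(\<lambda>n. (L + \<epsilon>) / 2 + inverse (real n) * inverse (real n)) \<longlonglongrightarrow> (L + \<epsilon>) / 2 + 0 * 0"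
    by (intro tendsto_intros lim_inverse_n)
  moreover have "(L + \<epsilon>) / 2 < a" using a by (simp add: \<epsilon>_def field_simps)
  ultimately have "\<forall>\<^sub>F n in at_top. (L + \<epsilon>) / 2 + inverse (real n) * inverse (real n) < a"
    by (intro order_tendstoD(2)) auto
  then show "\<forall>\<^sub>F n in at_top. g n / real n ^ 2 < a"
    using upper[OF \<epsilon>] eventually_gt_at_top[of 0]
  proof eventually_elim
    case (elim n)
    have "g n / real n ^ 2 \<le> ((L + \<epsilon>) * (real n)\<^sup>2 / 2 + 1) / real n ^ 2"
      using elim(2) by (intro divide_right_mono) auto
    also have "\<dots> = (L + \<epsilon>) / 2 + inverse (real n) * inverse (real n)"
      using elim(3) by (simp add: field_simps power2_eq_square)
    finally show ?case using elim(1) by linarith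
  qed
qed

lemma color_threshold_limit:
  assumes G: "simple_graph G" and F: "hereditary F" "complete_graph 2 \<in> F"
    and r: "reduced_chromatic_number F G = Suc r" "1 \<le> r"
  shows "(\<lambda>n. real (color_threshold n G F) / real n ^ 2) \<longlonglongrightarrow> (1 - 1 / r) / 2"
proof (rule quadratic_limit)
  show "(1 - 1 / r) * (real n * (real n - 1)) / 2 \<le> real (color_threshold n G F)" for n
    using card_edges_turan_graph[OF r(2), of n] color_threshold_lower[OF G F(1) r(2), of n] r(1)
    by (auto intro: order_trans)
qed (rule color_threshold_upper[OF assms])

lemma turan_number_limit:
  assumes r: "1 \<le> r"
  shows "(\<lambda>n. real (turan_number n (complete_graph (Suc r))) / real n ^ 2) \<longlonglongrightarrow> (1 - 1 / r) / 2"
proof (rule quadratic_limit)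
  show "(1 - 1 / r) * (real n * (real n - 1)) / 2 \<le> real (turan_number n (complete_graph (Suc r)))" for n
    using card_edges_turan_graph[OF r, of n] turan_number_lower[OF r, of n]
    by (auto intro: order_trans)
  fix \<epsilon> :: real assume "0 < \<epsilon>"
  from turan_number_upper[OF r this]
  show "\<forall>\<^sub>F n in at_top. real (turan_number n (complete_graph (Suc r))) \<le> (1 - 1 / r + \<epsilon>) * (real n)\<^sup>2 / 2 + 1"
    by eventually_elim linarith
qed

text \<open>
  Some deck member has a proper coloring with one color and thus no edges, so \<open>G\<close> itself belongs to
  \<open>F\<close> and every copy of \<open>G\<close> will do, whatever the coloring.
\<close>

lemma color_threshold_eq_1:
  assumes G: "simple_graph G" and F: "hereditary F"
    and red: "reduced_chromatic_number F G = 1" and n: "card (verts G) \<le> n"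
  shows "color_threshold n G F = 1"
proof -
  obtain D \<kappa> where D: "subgraph D G" "D \<in> F" and \<kappa>: "proper_coloring (delete_edges G D) 1 \<kappa>"
    using reduced_chromatic_number_attained[OF G F] red by metis
  have "edges G \<subseteq> edges D"
  proof (rule subsetI, rule ccontr)
    fix e assume e: "e \<in> edges G" "e \<notin> edges D"
    then obtain u v where uv: "e = {u, v}" "u \<in> verts G" "v \<in> verts G"
      using G by (auto simp: simple_graph_def elim!: nsets2_E)
    then have "\<kappa> u \<noteq> \<kappa> v" "\<kappa> u = 0" "\<kappa> v = 0"
      using \<kappa> e by (auto simp: proper_coloring_def delete_edges_def)
    then show False by simp
  qed
  then have "G \<in> F" using hereditary_fewer_edges[OF F D(2) G] by blast
  obtain \<phi> where \<phi>: "inj_on \<phi> (verts G)" "\<phi> ` verts G \<subseteq> {..<n}"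
    using card_le_inj[of "verts G" "{..<n}"] G n by (auto simp: simple_graph_def)
  define H where "H = map_graph \<phi> G"
  have "H \<in> F" and sH: "simple_graph H"
    using hereditary_map_graph[OF F \<open>G \<in> F\<close>] simple_graph_map_graph[OF G] \<phi> by (auto simp: H_def)
  have vH: "verts H \<subseteq> {..<n}" using \<phi> by (simp add: H_def map_graph_def)
  have "subgraph H (complete_graph n)"
    using sH vH nsets_mono[OF vH, of 2] by (auto simp: subgraph_def complete_graph_def simple_graph_def)
  then have "is_copy_in H G (complete_graph n)"
    using graph_iso_map_graph[OF \<phi>(1)] by (simp add: is_copy_in_def H_def)
  moreover have "color_class c H i \<in> F" for c i
    using hereditary_fewer_edges[OF F \<open>H \<in> F\<close>, of "color_class c H i"] sH
    by (auto simp: color_class_def simple_graph_def)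
  ultimately have good: "good_copy G F n c" for c unfolding good_copy_def by blast
  then have "color_threshold n G F \<le> 1" by (intro color_threshold_le) auto
  moreover have "0 < color_threshold n G F"
    unfolding color_threshold_good_copy
    by (rule LeastI2[of _ 1]) (use good in auto)
  ultimately show ?thesis by simp
qed

theorem theorem1p1:
  fixes G :: "nat graph" and F :: "nat graph set"
  assumes "simple_graph G"
    and "hereditary F"
    and "complete_graph 2 \<in> F"
  shows "(reduced_chromatic_number F G \<ge> 3 \<longrightarrow>
            (\<lambda>n. real (color_threshold n G F)) \<sim>[at_top]
            (\<lambda>n. real (turan_number n (complete_graph (reduced_chromatic_number F G))))) \<and>
         (reduced_chromatic_number F G = 2 \<longrightarrow>
            (\<lambda>n. real (color_threshold n G F)) \<in> o(\<lambda>n. real n ^ 2)) \<and>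
         (reduced_chromatic_number F G = 1 \<longrightarrow>
            (\<forall>n \<ge> card (verts G). color_threshold n G F = 1))"
proof (intro conjI impI)
  assume k: "reduced_chromatic_number F G \<ge> 3"
  define r where "r = reduced_chromatic_number F G - 1"
  have r: "reduced_chromatic_number F G = Suc r" "1 \<le> r" and "2 \<le> r" using k by (auto simp: r_def)
  define L where "L = (1 - 1 / real r) / 2"
  have L: "L \<noteq> 0" using \<open>2 \<le> r\<close> by (simp add: L_def)
  have equiv: "g \<sim>[at_top] (\<lambda>n. L * real n ^ 2)"
    if "(\<lambda>n. g n / real n ^ 2) \<longlonglongrightarrow> L" for g :: "nat \<Rightarrow> real"
  proof (rule asymp_equivI')
    have "(\<lambda>n. g n / real n ^ 2 / L) \<longlonglongrightarrow> L / L" using that L by (intro tendsto_divide tendsto_const)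
    then show "(\<lambda>n. g n / (L * real n ^ 2)) \<longlonglongrightarrow> 1" using L by (simp add: mult.commute)
  qed
  have "(\<lambda>n. real (color_threshold n G F)) \<sim>[at_top] (\<lambda>n. L * real n ^ 2)"
    using color_threshold_limit[OF assms r] by (intro equiv) (simp add: L_def)
  moreover have "(\<lambda>n. real (turan_number n (complete_graph (Suc r)))) \<sim>[at_top] (\<lambda>n. L * real n ^ 2)"
    using turan_number_limit[OF r(2)] by (intro equiv) (simp add: L_def)
  ultimately show "(\<lambda>n. real (color_threshold n G F)) \<sim>[at_top]
      (\<lambda>n. real (turan_number n (complete_graph (reduced_chromatic_number F G))))"
    unfolding r(1) using asymp_equiv_sym asymp_equiv_trans by blast
next
  assume "reduced_chromatic_number F G = 2"
  then have "(\<lambda>n. real (color_threshold n G F) / real n ^ 2) \<longlonglongrightarrow> 0"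
    using color_threshold_limit[OF assms, of 1] by (simp add: numeral_2_eq_2)
  then show "(\<lambda>n. real (color_threshold n G F)) \<in> o(\<lambda>n. real n ^ 2)"
    by (rule smalloI_tendsto) (use eventually_gt_at_top[of 0] in \<open>auto elim: eventually_mono\<close>)
next
  assume "reduced_chromatic_number F G = 1"
  then show "\<forall>n \<ge> card (verts G). color_threshold n G F = 1"
    using color_threshold_eq_1[OF assms(1,2)] by blast
qed

end
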